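(* Let $0\le r\le 1$ and let $u=(u_{ij})$ be a $2\times 2$ unitary matrix. Then $$\mathrm{d}_{\mathrm{KK}}(\Delta,u\Delta u^* )=r\iff |u_{ij}|=\frac{1}{\sqrt{1+r}\pm\sqrt{1-r}}\text{ for all } i,j.$$
   Context: $\Delta$ denotes the algebra of diagonal matrices in $\mathbb{M}_2(\mathbb{C})$, the algebra of $2\times 2$ complex matrices, and $u\Delta u^*=\{uxu^*:x\in\Delta\}$. Kadison--Kastler distance: for subspaces $\mathcal{Y},\mathcal{Z}$ of a normed space (here $\mathbb{M}_2(\mathbb{C})$ with the operator norm), with closed unit balls $(\mathcal{Y})_1,(\mathcal{Z})_1$ and $d(x,S)=\inf\{\|x-s\|:s\in S\}$, $$\mathrm{d}_{\mathrm{KK}}(\mathcal{Y},\mathcal{Z})=\max\Big\{\sup_{y\in(\mathcal{Y})_1}d(y,(\mathcal{Z})_1),\ \sup_{z\in(\mathcal{Z})_1}d(z,(\mathcal{Y})_1)\Big\}.$$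
   Formalization: The printed values 1/(√(1+r)±√(1−r)) are replaced by (√(1+r)±√(1−r))/2, the sign depending on (i,j); as printed the claim fails for r<1 (for r=0, u=I the distance is 0 but |u_11|=1, not 1/2 or 1/0), and the two agree at r=1. *)

theory Defs
  imports "HOL-Analysis.Analysis"
begin

text \<open>
  The built-in norm of \<^typ>\<open>complex^2^2\<close> is the Frobenius norm, so the operator norm (with respect
  to the Euclidean norm of \<^typ>\<open>complex^2\<close>) is introduced separately, and the Kadison--Kastler
  distance takes the norm as a parameter \<open>N\<close>.
\<close>

definition op_norm :: "complex^2^2 \<Rightarrow> real" where
  "op_norm A = onorm (\<lambda>x. A *v x)"

definition unit_ball_of :: "('a \<Rightarrow> real) \<Rightarrow> 'a set \<Rightarrow> 'a set" where
  "unit_ball_of N Y = {y \<in> Y. N y \<le> 1}"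

definition dist_to :: "('a::ab_group_add \<Rightarrow> real) \<Rightarrow> 'a \<Rightarrow> 'a set \<Rightarrow> real" where
  "dist_to N x S = (INF s\<in>S. N (x - s))"

text \<open>
  For subspaces \<open>Y\<close>, \<open>Z\<close> and a norm \<open>N\<close>, both unit balls contain 0. Hence the infima and suprema
  range over nonempty sets of reals in \<open>[0, \<infinity>)\<close> and \<open>[0, 1]\<close> respectively.
\<close>

definition kk_dist :: "('a::ab_group_add \<Rightarrow> real) \<Rightarrow> 'a set \<Rightarrow> 'a set \<Rightarrow> real" where
  "kk_dist N Y Z =
    max (SUP y\<in>unit_ball_of N Y. dist_to N y (unit_ball_of N Z))
        (SUP z\<in>unit_ball_of N Z. dist_to N z (unit_ball_of N Y))"

definition diagonal_matrices :: "(complex^2^2) set" where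
  "diagonal_matrices = {A. \<forall>i j. i \<noteq> j \<longrightarrow> A $ i $ j = 0}"

definition conj_transpose :: "complex^2^2 \<Rightarrow> complex^2^2" where
  "conj_transpose A = (\<chi> i j. cnj (A $ j $ i))"

definition unitary :: "complex^2^2 \<Rightarrow> bool" where
  "unitary u \<longleftrightarrow> conj_transpose u ** u = mat 1 \<and> u ** conj_transpose u = mat 1"

definition conjugate_by :: "complex^2^2 \<Rightarrow> (complex^2^2) set \<Rightarrow> (complex^2^2) set" where
  "conjugate_by u S = (\<lambda>x. u ** x ** conj_transpose u) ` S"

end

theory Submission
  imports Defs
begin

text \<open>
  The best approximant of a diagonal matrix \<open>x\<close> in the unit ball of \<open>u\<Delta>u\<^sup>*\<close> is \<open>uDu\<^sup>*\<close>, where \<open>D\<close> is the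
  diagonal part of \<open>u\<^sup>*xu\<close>: subtracting any other diagonal matrix leaves the off-diagonal entries
  unchanged, and the norm of a matrix dominates the modulus of each entry. For \<open>x = diag(z, w)\<close> these
  entries have modulus \<open>|u\<^sub>1\<^sub>1||u\<^sub>1\<^sub>2||z - w|\<close>, so the supremum over the unit ball of \<open>\<Delta>\<close> is
  \<open>2|u\<^sub>1\<^sub>1||u\<^sub>1\<^sub>2|\<close>, attained at \<open>diag(1, -1)\<close>. Exchanging the roles of the two algebras replaces \<open>u\<close> by
  \<open>u\<^sup>*\<close>, which gives the same value. Finally \<open>|u\<^sub>1\<^sub>1|\<^sup>2 + |u\<^sub>1\<^sub>2|\<^sup>2 = 1\<close>, and \<open>2ab = r\<close> with \<open>a\<^sup>2 + b\<^sup>2 = 1\<close>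
  means \<open>(a \<plusminus> b)\<^sup>2 = 1 \<plusminus> r\<close>.
\<close>

section \<open>Entrywise bounds for the operator norm\<close>

lemma norm_mult_vec_le: "norm (A *v x) \<le> op_norm A * norm x"
  unfolding op_norm_def
  by (rule onorm[OF matrix_vector_mul_bounded_linear])

lemma op_norm_nonneg: "0 \<le> op_norm A"
  unfolding op_norm_def
  by (rule onorm_pos_le[OF matrix_vector_mul_bounded_linear])

lemma op_norm_le:
  assumes "\<And>x. norm (A *v x) \<le> c * norm x"
  shows "op_norm A \<le> c"
  unfolding op_norm_def by (rule onorm_le) (rule assms)

lemma norm_vec2: "norm (x::complex^2) = sqrt ((cmod (x$1))\<^sup>2 + (cmod (x$2))\<^sup>2)"
  by (simp add: norm_vec_def L2_set_def UNIV_2)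

text \<open>The entry is a coordinate of the image of a standard unit vector. This bounds the
  diagonal of a contraction and gives the lower bound for the distance.\<close>

lemma cmod_entry_le_op_norm: "cmod (A $ i $ j) \<le> op_norm A"
proof -
  have "(A *v axis j 1) $ i = A $ i $ j"
    by (simp add: matrix_vector_mult_def axis_def if_distrib cong: if_cong)
  moreover have "norm (axis j (1::complex) :: complex^2) = 1"
    using exhaust_2[of j] by (auto simp: norm_vec2 axis_def)
  ultimately show ?thesis
    using Finite_Cartesian_Product.norm_nth_le[of "A *v axis j 1" i] norm_mult_vec_le[of A "axis j 1"]
    by simp
qed

lemma op_norm_diagonal_le:
  assumes "A \<in> diagonal_matrices" "cmod (A$1$1) \<le> c" "cmod (A$2$2) \<le> c"
  shows "op_norm A \<le> c"
proof (rule op_norm_le)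
  fix x :: "complex^2"
  have c: "0 \<le> c" using assms(2) norm_ge_zero order_trans by blast
  have z: "A$1$2 = 0" "A$2$1 = 0" using assms(1) by (auto simp: diagonal_matrices_def)
  have "(cmod (A$1$1 * x$1))\<^sup>2 \<le> (c * cmod (x$1))\<^sup>2" "(cmod (A$2$2 * x$2))\<^sup>2 \<le> (c * cmod (x$2))\<^sup>2"
    using assms by (auto simp: norm_mult intro!: power_mono mult_right_mono)
  then have "norm (A *v x) \<le> sqrt (c\<^sup>2 * ((cmod (x$1))\<^sup>2 + (cmod (x$2))\<^sup>2))"
    by (simp add: norm_vec2 matrix_vector_mult_def sum_2 z power_mult_distrib distrib_left)
  then show "norm (A *v x) \<le> c * norm x"
    using c by (simp add: norm_vec2 real_sqrt_mult)
qed

text \<open>Such a matrix swaps the two coordinates and scales each by at most \<open>c\<close>. It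
  is needed for what remains of a matrix once its diagonal part is subtracted.\<close>

lemma op_norm_antidiagonal_le:
  assumes "A$1$1 = 0" "A$2$2 = 0" "cmod (A$1$2) \<le> c" "cmod (A$2$1) \<le> c"
  shows "op_norm A \<le> c"
proof (rule op_norm_le)
  fix x :: "complex^2"
  have c: "0 \<le> c" using assms(3) norm_ge_zero order_trans by blast
  have "(cmod (A$1$2 * x$2))\<^sup>2 \<le> (c * cmod (x$2))\<^sup>2" "(cmod (A$2$1 * x$1))\<^sup>2 \<le> (c * cmod (x$1))\<^sup>2"
    using assms by (auto simp: norm_mult intro!: power_mono mult_right_mono)
  then have "norm (A *v x) \<le> sqrt (c\<^sup>2 * ((cmod (x$1))\<^sup>2 + (cmod (x$2))\<^sup>2))"
    by (simp add: norm_vec2 matrix_vector_mult_def sum_2 assms power_mult_distrib distrib_left)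
  then show "norm (A *v x) \<le> c * norm x"
    using c by (simp add: norm_vec2 real_sqrt_mult)
qed

section \<open>Unitary matrices and conjugation by them\<close>

lemma conj_transpose_conj_transpose [simp]: "conj_transpose (conj_transpose A) = A"
  by (simp add: conj_transpose_def vec_eq_iff)

lemma unitary_conj_transpose: "unitary u \<Longrightarrow> unitary (conj_transpose u)"
  by (simp add: unitary_def)

lemma unitary_entries:
  assumes "unitary u"
  shows "(cmod (u$1$1))\<^sup>2 + (cmod (u$1$2))\<^sup>2 = 1"
    and "cmod (u$2$1) = cmod (u$1$2)" and "cmod (u$2$2) = cmod (u$1$1)"
    and "cnj (u$1$1) * u$1$2 + cnj (u$2$1) * u$2$2 = 0"
proof -
  have e: "(conj_transpose u ** u) $ i $ j = mat 1 $ i $ j"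
          "(u ** conj_transpose u) $ i $ j = mat 1 $ i $ j" for i j
    using assms by (auto simp: unitary_def)
  have 1: "complex_of_real ((cmod (u$1$1))\<^sup>2 + (cmod (u$1$2))\<^sup>2) = of_real 1"
    using e(2)[of 1 1] unfolding of_real_add complex_norm_square
    by (simp add: matrix_matrix_mult_def conj_transpose_def sum_2 mat_def)
  have 2: "complex_of_real ((cmod (u$1$1))\<^sup>2 + (cmod (u$2$1))\<^sup>2) = of_real 1"
    using e(1)[of 1 1] unfolding of_real_add complex_norm_square
    by (simp add: matrix_matrix_mult_def conj_transpose_def sum_2 mat_def mult.commute)
  have 3: "complex_of_real ((cmod (u$2$1))\<^sup>2 + (cmod (u$2$2))\<^sup>2) = of_real 1"
    using e(2)[of 2 2] unfolding of_real_add complex_norm_square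
    by (simp add: matrix_matrix_mult_def conj_transpose_def sum_2 mat_def)
  note r = 1[unfolded of_real_eq_iff] 2[unfolded of_real_eq_iff] 3[unfolded of_real_eq_iff]
  show "(cmod (u$1$1))\<^sup>2 + (cmod (u$1$2))\<^sup>2 = 1" by (rule r(1))
  \<comment> \<open>The first row, first column and second row are unit vectors; comparing those
    that share an entry leaves these equalities.\<close>
  have "(cmod (u$2$1))\<^sup>2 = (cmod (u$1$2))\<^sup>2" "(cmod (u$2$2))\<^sup>2 = (cmod (u$1$1))\<^sup>2"
    using r by linarith+
  then show "cmod (u$2$1) = cmod (u$1$2)" "cmod (u$2$2) = cmod (u$1$1)" by simp_all
  show "cnj (u$1$1) * u$1$2 + cnj (u$2$1) * u$2$2 = 0"
    using e(1)[of 1 2]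
    by (simp add: matrix_matrix_mult_def conj_transpose_def sum_2 mat_def)
qed

lemma norm_unitary_mult_vec:
  assumes "unitary u"
  shows "norm (u *v x) = norm x"
proof -
  define p where "p = cnj (u$1$1) * u$1$2 + cnj (u$2$1) * u$2$2"
  have p: "p = 0" using unitary_entries(4)[OF assms] by (simp add: p_def)
  \<comment> \<open>Here \<open>p\<close> is the inner product of the columns of \<open>u\<close>:
    the cross terms carry \<open>p\<close> and its conjugate, so they vanish.\<close>
  have "complex_of_real ((cmod ((u *v x)$1))\<^sup>2 + (cmod ((u *v x)$2))\<^sup>2) =
    of_real ((cmod (u$1$1))\<^sup>2 + (cmod (u$2$1))\<^sup>2) * of_real ((cmod (x$1))\<^sup>2) +
    of_real ((cmod (u$1$2))\<^sup>2 + (cmod (u$2$2))\<^sup>2) * of_real ((cmod (x$2))\<^sup>2) +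
    p * x$2 * cnj (x$1) + cnj p * x$1 * cnj (x$2)"
    unfolding of_real_add complex_norm_square p_def
    by (simp add: matrix_vector_mult_def sum_2 algebra_simps)
  also have "\<dots> = of_real ((cmod (x$1))\<^sup>2 + (cmod (x$2))\<^sup>2)"
    using unitary_entries(1-3)[OF assms] p by (simp add: add.commute)
  finally have "(cmod ((u *v x)$1))\<^sup>2 + (cmod ((u *v x)$2))\<^sup>2 = (cmod (x$1))\<^sup>2 + (cmod (x$2))\<^sup>2"
    by (simp only: of_real_eq_iff)
  then show ?thesis by (simp add: norm_vec2)
qed

lemma conjugation_inverse:
  assumes "unitary u"
  shows "conj_transpose u ** (u ** x ** conj_transpose u) ** u = x"
    and "u ** (conj_transpose u ** x ** u) ** conj_transpose u = x"
proof -
  have e: "conj_transpose u ** u = mat 1" "u ** conj_transpose u = mat 1"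
    using assms by (auto simp: unitary_def)
  have "conj_transpose u ** (u ** x ** conj_transpose u) ** u =
      (conj_transpose u ** u) ** x ** (conj_transpose u ** u)"
    by (simp only: matrix_mul_assoc)
  then show "conj_transpose u ** (u ** x ** conj_transpose u) ** u = x" by (simp add: e)
  have "u ** (conj_transpose u ** x ** u) ** conj_transpose u =
      (u ** conj_transpose u) ** x ** (u ** conj_transpose u)"
    by (simp only: matrix_mul_assoc)
  then show "u ** (conj_transpose u ** x ** u) ** conj_transpose u = x" by (simp add: e)
qed

lemma op_norm_conjugation_unitary:
  assumes "unitary u"
  shows "op_norm (u ** A ** conj_transpose u) = op_norm A"
proof -
  have le: "op_norm (v ** B ** conj_transpose v) \<le> op_norm B" if "unitary v" for v B
  proof (rule op_norm_le)
    fix x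
    have "norm ((v ** B ** conj_transpose v) *v x) = norm (B *v (conj_transpose v *v x))"
      by (simp add: matrix_vector_mul_assoc[symmetric] norm_unitary_mult_vec[OF that])
    also have "\<dots> \<le> op_norm B * norm (conj_transpose v *v x)" by (rule norm_mult_vec_le)
    also have "norm (conj_transpose v *v x) = norm x"
      by (rule norm_unitary_mult_vec[OF unitary_conj_transpose[OF that]])
    finally show "norm ((v ** B ** conj_transpose v) *v x) \<le> op_norm B * norm x" .
  qed
  show ?thesis
    \<comment> \<open>The reverse inequality is the same bound for the inverse conjugation, by
      \<open>conj_transpose u\<close>.\<close>
    using le[OF assms, of A] le[OF unitary_conj_transpose[OF assms], of "u ** A ** conj_transpose u"]
    by (simp add: conjugation_inverse[OF assms])
qed

lemma conjugation_diff:
  "u ** (A - B) ** conj_transpose u = u ** A ** conj_transpose u - u ** B ** conj_transpose u"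
  by (simp add: vec_eq_iff matrix_matrix_mult_def sum_2 algebra_simps forall_2)

section \<open>Distances between the two unit balls\<close>

lemma unit_ball_conjugate_by:
  assumes "unitary u"
  shows "unit_ball_of op_norm (conjugate_by u S) = conjugate_by u (unit_ball_of op_norm S)"
  by (auto simp: unit_ball_of_def conjugate_by_def op_norm_conjugation_unitary[OF assms])

lemma dist_to_conjugate_by:
  assumes "unitary u"
  shows "dist_to op_norm (u ** x ** conj_transpose u) (conjugate_by u S) = dist_to op_norm x S"
  by (simp add: dist_to_def conjugate_by_def image_image conjugation_diff[symmetric]
      op_norm_conjugation_unitary[OF assms])

lemma zero_in_unit_ball_diagonal: "0 \<in> unit_ball_of op_norm diagonal_matrices"
proof -
  have "(0::complex^2^2) \<in> diagonal_matrices" by (simp add: diagonal_matrices_def)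
  then show ?thesis by (auto simp: unit_ball_of_def intro: op_norm_diagonal_le)
qed

lemma dist_to_op_norm_le:
  assumes "s \<in> S"
  shows "dist_to op_norm x S \<le> op_norm (x - s)"
  unfolding dist_to_def
  by (rule cINF_lower[OF _ assms]) (auto intro!: bdd_belowI op_norm_nonneg)

lemma conj_transpose_mult_diagonal_mult_entry:
  assumes "x \<in> diagonal_matrices"
  shows "(conj_transpose u ** x ** u) $ i $ j =
    cnj (u$1$i) * x$1$1 * u$1$j + cnj (u$2$i) * x$2$2 * u$2$j"
proof -
  have "x$1$2 = 0" "x$2$1 = 0" using assms by (auto simp: diagonal_matrices_def)
  then show ?thesis by (simp add: matrix_matrix_mult_def conj_transpose_def sum_2)
qed

text \<open>Conjugating back by \<open>u\<close> is isometric, so the rotated algebra can be traded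
  for a rotated point.\<close>

lemma dist_to_conjugated_diagonal_ball:
  assumes "unitary u"
  shows "dist_to op_norm x (unit_ball_of op_norm (conjugate_by u diagonal_matrices)) =
    dist_to op_norm (conj_transpose u ** x ** u) (unit_ball_of op_norm diagonal_matrices)"
  using dist_to_conjugate_by[OF assms, of "conj_transpose u ** x ** u"]
  by (simp add: unit_ball_conjugate_by[OF assms] conjugation_inverse[OF assms])

lemma dist_to_conjugated_diagonal_le:
  assumes u: "unitary u" and x: "x \<in> unit_ball_of op_norm diagonal_matrices"
  shows "dist_to op_norm x (unit_ball_of op_norm (conjugate_by u diagonal_matrices))
    \<le> 2 * cmod (u$1$1) * cmod (u$1$2)"
proof -
  define y where "y = conj_transpose u ** x ** u"
  define D where "D = (\<chi> i j. if i = j then y $ i $ j else 0)"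
  have xd: "x \<in> diagonal_matrices" and "op_norm x \<le> 1" using x by (auto simp: unit_ball_of_def)
  then have x1: "cmod (x$i$i) \<le> 1" for i using cmod_entry_le_op_norm order_trans by blast
  note ye = conj_transpose_mult_diagonal_mult_entry[OF xd, of u, folded y_def]
  have sq: "(cmod (u$1$i))\<^sup>2 + (cmod (u$2$i))\<^sup>2 = 1" for i
    using unitary_entries(1-3)[OF u] exhaust_2[of i] by (auto simp: add.commute)
  \<comment> \<open>Each diagonal entry of \<open>y\<close> is a convex combination of those of
    \<open>x\<close>, with weights the squared moduli in a column of \<open>u\<close>; hence
    \<open>D\<close> lies in the unit ball.\<close>
  have diag: "cmod (y$i$i) \<le> 1" for i
  proof -
    have "cmod (y$i$i) \<le> cmod (cnj (u$1$i) * x$1$1 * u$1$i) + cmod (cnj (u$2$i) * x$2$2 * u$2$i)"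
      unfolding ye by (rule norm_triangle_ineq)
    also have "\<dots> = (cmod (u$1$i))\<^sup>2 * cmod (x$1$1) + (cmod (u$2$i))\<^sup>2 * cmod (x$2$2)"
      by (simp add: norm_mult power2_eq_square)
    also have "\<dots> \<le> (cmod (u$1$i))\<^sup>2 * 1 + (cmod (u$2$i))\<^sup>2 * 1"
      by (intro add_mono mult_left_mono x1) auto
    finally show ?thesis using sq by simp
  qed
  have Dd: "D \<in> diagonal_matrices" by (simp add: D_def diagonal_matrices_def)
  then have D: "D \<in> unit_ball_of op_norm diagonal_matrices"
    using diag by (auto simp: unit_ball_of_def D_def intro!: op_norm_diagonal_le)
  have h: "cmod (x$1$1 - x$2$2) \<le> 2"
    using norm_triangle_ineq4[of "x$1$1" "x$2$2"] x1[of 1] x1[of 2] by linarith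
  \<comment> \<open>Orthogonality of the columns makes the two coefficients in an off-diagonal entry
    of \<open>y\<close> opposite, so only the difference of the diagonal entries of \<open>x\<close>
    survives.\<close>
  have o: "cnj (u$2$1) * u$2$2 = - (cnj (u$1$1) * u$1$2)"
    using unitary_entries(4)[OF u] by (simp add: eq_neg_iff_add_eq_0 add.commute)
  have o': "u$2$1 * cnj (u$2$2) = - (u$1$1 * cnj (u$1$2))"
    using arg_cong[OF o, of cnj] by simp
  have "y$1$2 = cnj (u$1$1) * u$1$2 * (x$1$1 - x$2$2)"
  proof -
    have "y$1$2 = cnj (u$1$1) * u$1$2 * x$1$1 + (cnj (u$2$1) * u$2$2) * x$2$2"
      by (simp add: ye)
    then show ?thesis by (simp add: o algebra_simps)
  qed
  moreover have "y$2$1 = u$1$1 * cnj (u$1$2) * (x$1$1 - x$2$2)"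
  proof -
    have "y$2$1 = u$1$1 * cnj (u$1$2) * x$1$1 + (u$2$1 * cnj (u$2$2)) * x$2$2"
      by (simp add: ye)
    then show ?thesis by (simp add: o' algebra_simps)
  qed
  ultimately have "cmod (y$1$2) = cmod (u$1$1) * cmod (u$1$2) * cmod (x$1$1 - x$2$2)"
    "cmod (y$2$1) = cmod (u$1$1) * cmod (u$1$2) * cmod (x$1$1 - x$2$2)"
    by (simp_all add: norm_mult)
  then have "cmod (y$1$2) \<le> cmod (u$1$1) * cmod (u$1$2) * 2"
    "cmod (y$2$1) \<le> cmod (u$1$1) * cmod (u$1$2) * 2"
    by (auto intro!: mult_left_mono h)
  then have "op_norm (y - D) \<le> 2 * cmod (u$1$1) * cmod (u$1$2)"
    by (intro op_norm_antidiagonal_le) (simp_all add: D_def)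
  with dist_to_op_norm_le[OF D, of y] show ?thesis
    by (simp add: dist_to_conjugated_diagonal_ball[OF u] y_def)
qed

lemma dist_to_conjugated_diagonal_ge:
  assumes u: "unitary u" and x: "x \<in> diagonal_matrices" "x$1$1 = 1" "x$2$2 = -1"
  shows "2 * cmod (u$1$1) * cmod (u$1$2)
    \<le> dist_to op_norm x (unit_ball_of op_norm (conjugate_by u diagonal_matrices))"
proof -
  define y where "y = conj_transpose u ** x ** u"
  \<comment> \<open>For this \<open>x\<close> the entry is the difference of two terms whose sum is
    zero, hence twice the first.\<close>
  have "y$1$2 = 2 * (cnj (u$1$1) * u$1$2)"
    using unitary_entries(4)[OF u]
    unfolding y_def conj_transpose_mult_diagonal_mult_entry[OF x(1)] x
    by (simp add: eq_neg_iff_add_eq_0[symmetric])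
  then have y: "cmod (y$1$2) = 2 * cmod (u$1$1) * cmod (u$1$2)" by (simp add: norm_mult)
  have "2 * cmod (u$1$1) * cmod (u$1$2) \<le> dist_to op_norm y (unit_ball_of op_norm diagonal_matrices)"
    unfolding dist_to_def
  proof (rule cINF_greatest)
    show "unit_ball_of op_norm diagonal_matrices \<noteq> {}" using zero_in_unit_ball_diagonal by auto
    fix s assume "s \<in> unit_ball_of op_norm diagonal_matrices"
    then have "s$1$2 = 0" by (auto simp: unit_ball_of_def diagonal_matrices_def)
    then show "2 * cmod (u$1$1) * cmod (u$1$2) \<le> op_norm (y - s)"
      using cmod_entry_le_op_norm[of "y - s" 1 2] y by simp
  qed
  then show ?thesis by (simp add: dist_to_conjugated_diagonal_ball[OF u] y_def)
qed

lemma SUP_dist_to_conjugated_diagonal: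
  assumes u: "unitary u"
  shows "(SUP x\<in>unit_ball_of op_norm diagonal_matrices.
      dist_to op_norm x (unit_ball_of op_norm (conjugate_by u diagonal_matrices)))
    = 2 * cmod (u$1$1) * cmod (u$1$2)"
proof (rule cSup_eq_maximum)
  define x :: "complex^2^2" where "x = (\<chi> i j. if i = j then if i = 1 then 1 else -1 else 0)"
  have x: "x \<in> diagonal_matrices" "x$1$1 = 1" "x$2$2 = -1"
    by (simp_all add: x_def diagonal_matrices_def)
  then have xb: "x \<in> unit_ball_of op_norm diagonal_matrices"
    by (auto simp: unit_ball_of_def intro!: op_norm_diagonal_le)
  show "2 * cmod (u$1$1) * cmod (u$1$2) \<in>
     (\<lambda>x. dist_to op_norm x (unit_ball_of op_norm (conjugate_by u diagonal_matrices))) `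
       unit_ball_of op_norm diagonal_matrices"
    using dist_to_conjugated_diagonal_le[OF u xb] dist_to_conjugated_diagonal_ge[OF u x] xb
    by (intro image_eqI[of _ _ x]) auto
qed (auto intro: dist_to_conjugated_diagonal_le[OF u])

lemma kk_dist_diagonal_conjugate:
  assumes u: "unitary u"
  shows "kk_dist op_norm diagonal_matrices (conjugate_by u diagonal_matrices) =
    2 * cmod (u$1$1) * cmod (u$1$2)"
proof -
  let ?v = "conj_transpose u" and ?B = "unit_ball_of op_norm"
  note v = unitary_conj_transpose[OF u]
  have "(SUP z\<in>?B (conjugate_by u diagonal_matrices). dist_to op_norm z (?B diagonal_matrices)) =
    (SUP x\<in>?B diagonal_matrices. dist_to op_norm (u ** x ** ?v) (?B diagonal_matrices))"
    unfolding unit_ball_conjugate_by[OF u] by (simp add: conjugate_by_def image_image)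
  \<comment> \<open>This is the transfer of distances for \<open>conj_transpose u\<close>, read from
    right to left.\<close>
  also have "\<dots> = (SUP x\<in>?B diagonal_matrices. dist_to op_norm x (?B (conjugate_by ?v diagonal_matrices)))"
    using dist_to_conjugated_diagonal_ball[OF v] by simp
  also have "\<dots> = 2 * cmod (u$1$1) * cmod (u$1$2)"
    using SUP_dist_to_conjugated_diagonal[OF v] unitary_entries(2)[OF u]
    by (simp add: conj_transpose_def)
  finally show ?thesis
    by (simp add: kk_dist_def SUP_dist_to_conjugated_diagonal[OF u])
qed

text \<open>With s = sqrt(1 + r) and t = sqrt(1 - r), the moduli are (s + t)/2 and (s - t)/2. The
  reciprocals of s - t and s + t are these values divided by \<open>r\<close>, so they agree only at
  \<open>r = 1\<close>.\<close>

theorem theoremC: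
  fixes r :: real and u :: "complex^2^2"
  assumes "0 \<le> r" and "r \<le> 1" and "unitary u"
  shows "kk_dist op_norm diagonal_matrices (conjugate_by u diagonal_matrices) = r \<longleftrightarrow>
    (\<forall>i j. cmod (u $ i $ j) = (sqrt (1 + r) + sqrt (1 - r)) / 2 \<or>
           cmod (u $ i $ j) = (sqrt (1 + r) - sqrt (1 - r)) / 2)"
proof -
  define a where "a = cmod (u$1$1)"
  define b where "b = cmod (u$1$2)"
  define s where "s = sqrt (1 + r)"
  define t where "t = sqrt (1 - r)"
  have nn: "0 \<le> a" "0 \<le> b" "0 \<le> t" "t \<le> s"
    using assms by (auto simp: a_def b_def s_def t_def)
  have ab: "a\<^sup>2 + b\<^sup>2 = 1" using unitary_entries(1)[OF assms(3)] by (simp add: a_def b_def)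
  have st: "s\<^sup>2 = 1 + r" "t\<^sup>2 = 1 - r" using assms by (simp_all add: s_def t_def)
  have "2 * a * b = r \<longleftrightarrow> (a = (s + t) / 2 \<or> a = (s - t) / 2) \<and> (b = (s + t) / 2 \<or> b = (s - t) / 2)"
    (is "_ \<longleftrightarrow> ?R")
  proof
    assume r: "2 * a * b = r"
    have "(a + b)\<^sup>2 = s\<^sup>2" "(a - b)\<^sup>2 = t\<^sup>2"
      using r ab st by (simp_all add: power2_sum power2_diff)
    \<comment> \<open>Nonnegativity fixes the sign of the sum but not of the difference, so either
      of \<open>a\<close> and \<open>b\<close> may be the larger value.\<close>
    then have "a + b = s" "a - b = t \<or> a - b = - t"
      using nn by (auto simp: power2_eq_iff)
    then show ?R by (auto simp: field_simps)
  next
    have pq: "((s + t) / 2)\<^sup>2 + ((s - t) / 2)\<^sup>2 = 1" "2 * ((s + t) / 2) * ((s - t) / 2) = r"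
      "2 * ((s - t) / 2) * ((s + t) / 2) = r"
      using st by (simp_all add: power2_eq_square field_simps)
    assume ?R
    then consider "a = (s + t) / 2" | "a = (s - t) / 2" by blast
    then show "2 * a * b = r"
    proof cases
      case 1
      \<comment> \<open>\<open>?R\<close> alone would let \<open>a\<close> and \<open>b\<close> take
        the same value; the unit row forces the complementary one.\<close>
      have "b\<^sup>2 = ((s - t) / 2)\<^sup>2" using ab pq(1) unfolding 1 by linarith
      then have "b = (s - t) / 2" by (rule power2_eq_imp_eq) (use nn in auto)
      then show ?thesis using pq(2) by (simp only: 1)
    next
      case 2
      have "b\<^sup>2 = ((s + t) / 2)\<^sup>2" using ab pq(1) unfolding 2 by linarith
      then have "b = (s + t) / 2" by (rule power2_eq_imp_eq) (use nn in auto)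
      then show ?thesis using pq(3) by (simp only: 2)
    qed
  qed
  \<comment> \<open>The second row has the moduli of the first in reverse order, so \<open>a\<close>
    and \<open>b\<close> decide all four entries.\<close>
  then show ?thesis
    using unitary_entries(2,3)[OF assms(3)]
    by (auto simp: kk_dist_diagonal_conjugate[OF assms(3)] forall_2 a_def b_def s_def t_def)
qed

end
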